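(* Let $a > 0$ and let $\mu$ be a finite positive Borel measure on $\mathbb{R}$ such that $\varphi(t) := \mathcal{L}(\mu)(|t|)$ is finite for all $|t| \le a$. (a) If $\mathcal{L}(\mu)'(a-) \le 0$, then $\varphi$ is reflection positive on $[-a,a]$, and $\varphi$ extends to a symmetric positive definite function on $\mathbb{R}$. (b) If $\varphi$ is reflection positive on $[-a,a]$ and non-constant, then there exists an element $b \in (0,a]$ with $\mathcal{L}(\mu)'(b-) < 0$.
   Context: The Laplace transform of a positive Borel measure $\mu$ on $\mathbb{R}$ is $\mathcal{L}(\mu)(t) = \int_{\mathbb{R}} e^{-\lambda t}\, d\mu(\lambda)$. For a convex function $g$ on $[0,a]$ and $b \in (0,a]$, $g'(b-) = \lim_{t \to b-} \frac{g(b)-g(t)}{b-t} \in (-\infty,\infty]$ denotes the left derivative at $b$; here it is applied to the convex function $g = \mathcal{L}(\mu)|_{[0,a]}$. A kernel $Q : X\times X \to \mathbb{C}$ is positive definite if it is hermitian, i.e. $Q(x,y)=\overline{Q(y,x)}$, and $\sum_{j,k=1}^n c_j\overline{c_k}\,Q(x_j,x_k) \ge 0$ for all $n$, $x_1,\dots,x_n \in X$, $c_1,\dots,c_n\in\mathbb{C}$. A function $\varphi : [-a,a] \to \mathbb{R}$ is reflection positive if both kernels $\varphi\big(\frac{t-s}{2}\big)_{-a \le s,t \le a}$ and $\varphi\big(\frac{t+s}{2}\big)_{0 \le s,t \le a}$ are positive definite. A function $\Phi : \mathbb{R}\to\mathbb{R}$ is symmetric if $\Phi(-t) = \Phi(t)$,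 and positive definite on $\mathbb{R}$ if the kernel $(\Phi(s-t))_{s,t\in\mathbb{R}}$ is positive definite. *)

theory Defs
  imports "HOL-Analysis.Analysis"
begin

definition laplace :: "real measure \<Rightarrow> real \<Rightarrow> ennreal" where
  "laplace \<mu> t = (\<integral>\<^sup>+ x. ennreal (exp (- x * t)) \<partial>\<mu>)"

(* The value is extended real because the left derivative of a convex function at the right
   endpoint of its domain may be \<infinity>. For convex g the difference quotient is monotone in t,
   so the limit exists. *)
definition left_deriv :: "(real \<Rightarrow> real) \<Rightarrow> real \<Rightarrow> ereal" where
  "left_deriv g b = Lim (at_left b) (\<lambda>t. ereal ((g b - g t) / (b - t)))"

definition positive_definite_kernel :: "'a set \<Rightarrow> ('a \<Rightarrow> 'a \<Rightarrow> complex) \<Rightarrow> bool" where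
  "positive_definite_kernel X Q \<longleftrightarrow>
     (\<forall>x\<in>X. \<forall>y\<in>X. Q x y = cnj (Q y x)) \<and>
     (\<forall>(n::nat) (x :: nat \<Rightarrow> 'a) (c :: nat \<Rightarrow> complex). (\<forall>j\<in>{1..n}. x j \<in> X) \<longrightarrow>
        (\<Sum>j=1..n. \<Sum>k=1..n. c j * cnj (c k) * Q (x j) (x k)) \<in> \<real>\<^sub>\<ge>\<^sub>0)"

(* Only the values of \<phi> on [-a, a] enter. *)
definition reflection_positive :: "real \<Rightarrow> (real \<Rightarrow> real) \<Rightarrow> bool" where
  "reflection_positive a \<phi> \<longleftrightarrow>
     positive_definite_kernel {-a..a} (\<lambda>s t. complex_of_real (\<phi> ((t - s) / 2))) \<and>
     positive_definite_kernel {0..a} (\<lambda>s t. complex_of_real (\<phi> ((t + s) / 2)))"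

definition symmetric_fun :: "(real \<Rightarrow> real) \<Rightarrow> bool" where
  "symmetric_fun \<Phi> \<longleftrightarrow> (\<forall>t. \<Phi> (- t) = \<Phi> t)"

definition positive_definite_fun :: "(real \<Rightarrow> real) \<Rightarrow> bool" where
  "positive_definite_fun \<Phi> \<longleftrightarrow>
     positive_definite_kernel UNIV (\<lambda>s t. complex_of_real (\<Phi> (s - t)))"

end

theory Submission
  imports Defs
begin

text \<open>
  Write \<open>g = \<L>(\<mu>)\<close>, which is convex and continuous on \<open>[0,a]\<close>. For (a), convexity and
  \<open>g'(a-) \<le> 0\<close> make \<open>g\<close> nonincreasing on \<open>[0,a]\<close>, so \<open>g(min t a)\<close> is convex, nonincreasing and
  nonnegative on \<open>[0,\<infinity>)\<close>, and Polya's criterion yields a positive definite extension. Since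
  positive definiteness only tests finitely many values, Polya's criterion follows by
  interpolating with nonnegative combinations of tents \<open>max 0 (r - \<bar>t\<bar>)\<close> and constants; a tent is
  the Gram kernel of indicators of translated intervals. The kernel \<open>\<phi>((t+s)/2)\<close> is the Gram
  kernel of the functions \<open>exp(-\<lambda>s/2)\<close> in \<open>L\<^sup>2(\<mu>)\<close>. For (b), positive definiteness gives
  \<open>\<phi> \<le> \<phi>(0)\<close>, so \<open>g(t) < g(0)\<close> for some \<open>t\<close>; by continuity at \<open>0\<close> some \<open>0 < b < t\<close> has
  \<open>g(b) > g(t)\<close>, and the left derivative at \<open>b\<close> is at most the slope of \<open>g\<close> between \<open>b\<close> and \<open>t\<close>.
\<close>

section \<open>Positive definite kernels\<close>

text \<open>Interchanging the finite sums with the integral turns the quadratic form into the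
  integral of |sum_j c_j F(x_j)|^2. The measure is left arbitrary because the lemma serves three
  cases: a one-point counting measure, Lebesgue measure, and \<open>\<mu>\<close> itself.\<close>

lemma positive_definite_kernel_Gram:
  fixes F :: "'a \<Rightarrow> 'b \<Rightarrow> real"
  assumes int: "\<And>s t. s \<in> X \<Longrightarrow> t \<in> X \<Longrightarrow> integrable M (\<lambda>u. F s u * F t u)"
    and Q: "\<And>s t. s \<in> X \<Longrightarrow> t \<in> X \<Longrightarrow> Q s t = (\<integral>u. F s u * F t u \<partial>M)"
  shows "positive_definite_kernel X (\<lambda>s t. complex_of_real (Q s t))"
  unfolding positive_definite_kernel_def
proof (intro conjI ballI allI impI)
  fix x y assume "x \<in> X" "y \<in> X"
  then show "complex_of_real (Q x y) = cnj (complex_of_real (Q y x))"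
    by (simp add: Q mult.commute)
next
  fix n :: nat and x :: "nat \<Rightarrow> 'a" and c :: "nat \<Rightarrow> complex"
  assume x: "\<forall>j\<in>{1..n}. x j \<in> X"
  have int': "integrable M (\<lambda>u. c j * cnj (c k) * complex_of_real (F (x j) u * F (x k) u))"
    if "j \<in> {1..n}" "k \<in> {1..n}" for j k
    by (intro integrable_mult_right integrable_of_real int) (use x that in auto)
  have "(\<Sum>j=1..n. \<Sum>k=1..n. c j * cnj (c k) * complex_of_real (Q (x j) (x k)))
      = (\<Sum>j=1..n. \<Sum>k=1..n. \<integral>u. c j * cnj (c k) * complex_of_real (F (x j) u * F (x k) u) \<partial>M)"
  proof (intro sum.cong refl)
    fix j k assume "j \<in> {1..n}" "k \<in> {1..n}"
    then have "Q (x j) (x k) = (\<integral>u. F (x j) u * F (x k) u \<partial>M)"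
      using x Q by auto
    then show "c j * cnj (c k) * complex_of_real (Q (x j) (x k))
      = (\<integral>u. c j * cnj (c k) * complex_of_real (F (x j) u * F (x k) u) \<partial>M)"
      by (simp only: integral_mult_right_zero integral_complex_of_real)
  qed
  also have "\<dots> = (\<Sum>j=1..n. \<integral>u. (\<Sum>k=1..n. c j * cnj (c k) * complex_of_real (F (x j) u * F (x k) u)) \<partial>M)"
    by (intro sum.cong refl Bochner_Integration.integral_sum[symmetric] int')
  also have "\<dots> = (\<integral>u. (\<Sum>j=1..n. \<Sum>k=1..n. c j * cnj (c k) * complex_of_real (F (x j) u * F (x k) u)) \<partial>M)"
    by (intro Bochner_Integration.integral_sum[symmetric] Bochner_Integration.integrable_sum int')
  also have "\<dots> = (\<integral>u. complex_of_real ((cmod (\<Sum>j=1..n. c j * complex_of_real (F (x j) u)))\<^sup>2) \<partial>M)"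
  proof (intro Bochner_Integration.integral_cong refl)
    fix u
    show "(\<Sum>j=1..n. \<Sum>k=1..n. c j * cnj (c k) * complex_of_real (F (x j) u * F (x k) u))
      = complex_of_real ((cmod (\<Sum>j=1..n. c j * complex_of_real (F (x j) u)))\<^sup>2)"
      unfolding complex_norm_square cnj_sum sum_product
      by (intro sum.cong refl) (simp add: mult_ac)
  qed
  also have "\<dots> = complex_of_real (\<integral>u. (cmod (\<Sum>j=1..n. c j * complex_of_real (F (x j) u)))\<^sup>2 \<partial>M)"
    by (rule integral_complex_of_real)
  also have "\<dots> \<in> \<real>\<^sub>\<ge>\<^sub>0"
    by (simp)
  finally show "(\<Sum>j=1..n. \<Sum>k=1..n. c j * cnj (c k) * complex_of_real (Q (x j) (x k))) \<in> \<real>\<^sub>\<ge>\<^sub>0" .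
qed

lemma positive_definite_kernel_add:
  assumes "positive_definite_kernel X P" "positive_definite_kernel X Q"
  shows "positive_definite_kernel X (\<lambda>s t. P s t + Q s t)"
  using assms unfolding positive_definite_kernel_def distrib_left sum.distrib complex_cnj_add
  by (intro conjI ballI allI impI nonneg_Reals_add_I arg_cong2[of _ _ _ _ "(+)"]) blast+

lemma positive_definite_kernel_cong:
  assumes "X = Y" "\<And>s t. s \<in> Y \<Longrightarrow> t \<in> Y \<Longrightarrow> P s t = Q s t"
  shows "positive_definite_kernel X P \<longleftrightarrow> positive_definite_kernel Y Q"
  unfolding positive_definite_kernel_def \<open>X = Y\<close>
  by (intro arg_cong2[of _ _ _ _ "(\<and>)"] ball_cong all_cong refl)
     (auto simp: assms(2) intro!: arg_cong[of _ _ "\<lambda>z. z \<in> \<real>\<^sub>\<ge>\<^sub>0"] sum.cong)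

lemma positive_definite_kernel_compose:
  assumes "positive_definite_kernel Y Q" "\<And>x. x \<in> X \<Longrightarrow> h x \<in> Y"
  shows "positive_definite_kernel X (\<lambda>s t. Q (h s) (h t))"
  unfolding positive_definite_kernel_def
proof (intro conjI ballI allI impI)
  fix x y assume "x \<in> X" "y \<in> X"
  then show "Q (h x) (h y) = cnj (Q (h y) (h x))"
    using assms unfolding positive_definite_kernel_def by blast
next
  fix n :: nat and x :: "nat \<Rightarrow> _" and c :: "nat \<Rightarrow> complex"
  assume "\<forall>j\<in>{1..n}. x j \<in> X"
  then have "\<forall>j\<in>{1..n}. h (x j) \<in> Y"
    using assms(2) by blast
  then show "(\<Sum>j=1..n. \<Sum>k=1..n. c j * cnj (c k) * Q (h (x j)) (h (x k))) \<in> \<real>\<^sub>\<ge>\<^sub>0"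
    using assms(1)[unfolded positive_definite_kernel_def, THEN conjunct2, rule_format, of n "\<lambda>j. h (x j)" c]
    by blast
qed

lemma positive_definite_fun_add:
  assumes "positive_definite_fun f" "positive_definite_fun g"
  shows "positive_definite_fun (\<lambda>t. f t + g t)"
  using positive_definite_kernel_add[OF assms[unfolded positive_definite_fun_def]]
  by (simp add: positive_definite_fun_def)

lemma positive_definite_fun_const:
  assumes "0 \<le> w"
  shows "positive_definite_fun (\<lambda>_. w)"
  unfolding positive_definite_fun_def
  \<comment> \<open>Over a one-point space the integral is the single product
    \<open>sqrt w * sqrt w\<close>.\<close>
  by (rule positive_definite_kernel_Gram[where M = "count_space {()}" and F = "\<lambda>_ _. sqrt w"])
     (use assms in \<open>auto simp: lebesgue_integral_count_space_finite integrable_count_space\<close>)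

text \<open>The intervals [s, s+r] and [t, t+r] overlap in length max 0 (r - |s-t|), and each factor
  carries half of the weight as \<open>sqrt w\<close>. For negative \<open>r\<close> the intervals
  are empty and the tent is zero.\<close>

lemma positive_definite_fun_tent:
  assumes "0 \<le> w"
  shows "positive_definite_fun (\<lambda>t. w * max 0 (r - \<bar>t\<bar>))"
  unfolding positive_definite_fun_def
proof (rule positive_definite_kernel_Gram[where M = lborel and F = "\<lambda>s u. sqrt w * indicator {s..s+r} u"])
  have prod: "(\<lambda>u. sqrt w * indicator {s..s+r} u * (sqrt w * indicator {t..t+r} u))
      = (\<lambda>u. w * indicator {max s t..min s t + r} u)" for s t :: real
    using assms by (auto simp: indicator_def fun_eq_iff)
  fix s t :: real
  show "integrable lborel (\<lambda>u. sqrt w * indicator {s..s+r} u * (sqrt w * indicator {t..t+r} u))"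
    unfolding prod by (auto intro!: integrable_real_indicator simp: emeasure_lborel_Icc_eq)
  show "w * max 0 (r - \<bar>s - t\<bar>) = (\<integral>u. sqrt w * indicator {s..s+r} u * (sqrt w * indicator {t..t+r} u) \<partial>lborel)"
    unfolding prod by (auto simp: measure_def emeasure_lborel_Icc_eq)
qed

section \<open>Polya's criterion\<close>

text \<open>The extra conclusions (affine to the left of the nodes, and a minorant of \<open>f\<close> there) let the
  induction add nodes from right to left: the next tent then has a nonnegative coefficient and
  vanishes at the nodes already treated.\<close>
lemma polya_interpolation:
  fixes f :: "real \<Rightarrow> real"
  assumes conv: "convex_on {0..} f" and mono: "antimono_on {0..} f"
    and nonneg: "\<And>t. 0 \<le> t \<Longrightarrow> 0 \<le> f t"
  assumes "finite D" "D \<subseteq> {0..}"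
  obtains h p q where "positive_definite_fun (\<lambda>t. h \<bar>t\<bar>)" "\<And>d. d \<in> D \<Longrightarrow> h d = f d"
    "\<And>t. \<forall>d\<in>D. t \<le> d \<Longrightarrow> h t = p + q * t"
    "\<And>t. 0 \<le> t \<Longrightarrow> D \<noteq> {} \<Longrightarrow> \<forall>d\<in>D. t \<le> d \<Longrightarrow> h t \<le> f t"
proof -
  have "\<exists>h p q. positive_definite_fun (\<lambda>t. h \<bar>t\<bar>) \<and> (\<forall>d\<in>D. h d = f d) \<and>
    (\<forall>t. (\<forall>d\<in>D. t \<le> d) \<longrightarrow> h t = p + q * t) \<and>
    (D \<noteq> {} \<longrightarrow> (\<forall>t\<ge>0. (\<forall>d\<in>D. t \<le> d) \<longrightarrow> h t \<le> f t))"
    using assms(4,5)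
  proof (induction D rule: finite_linorder_min_induct)
    case empty
    show ?case
      by (intro exI[of _ "\<lambda>_. 0"] exI[of _ 0]) (auto simp: positive_definite_fun_const)
  next
    case (insert b D)
    then have b0: "0 \<le> b" by auto
    show ?case
    proof (cases "D = {}")
      case True
      \<comment> \<open>A single node is interpolated by the constant \<open>f b\<close>;
        monotonicity makes it a minorant to the left of \<open>b\<close>.\<close>
      have "f b \<le> f t" if "0 \<le> t" "t \<le> b" for t
        using mono that by (auto simp: monotone_on_def)
      with True show ?thesis
        by (intro exI[of _ "\<lambda>_. f b"] exI[of _ "f b"] exI[of _ 0])
           (auto simp: positive_definite_fun_const nonneg b0)
    next
      case False
      obtain h p q where pd: "positive_definite_fun (\<lambda>t. h \<bar>t\<bar>)" and eq: "\<And>d. d \<in> D \<Longrightarrow> h d = f d"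
        and aff: "\<And>t. \<forall>d\<in>D. t \<le> d \<Longrightarrow> h t = p + q * t"
        and le: "\<And>t. 0 \<le> t \<Longrightarrow> \<forall>d\<in>D. t \<le> d \<Longrightarrow> h t \<le> f t"
        using insert.IH insert.prems False by (auto simp del: all_simps) blast
      define d where "d = Min D"
      have d: "d \<in> D" "\<And>e. e \<in> D \<Longrightarrow> d \<le> e" "b < d"
        using insert.hyps False unfolding d_def by auto
      \<comment> \<open>The tent with foot at \<open>d\<close> has height \<open>d - b\<close> at
        \<open>b\<close>, so this weight lifts \<open>h b\<close> exactly to \<open>f b\<close>. The
        minorant property from the induction gives its sign.\<close>
      define w where "w = (f b - h b) / (d - b)"
      have w: "0 \<le> w"
        using le[OF b0] insert.hyps(2) d(3) by (auto simp: w_def less_imp_le)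
      \<comment> \<open>Writing \<open>d - t\<close> without an absolute value keeps
        \<open>h'\<close> affine for all \<open>t\<close> below \<open>d\<close>, negative ones
        included; evenness enters only through \<open>h' \<bar>t\<bar>\<close>.\<close>
      define h' where "h' = (\<lambda>t. h t + w * max 0 (d - t))"
      have aff': "h' t = (p + w * d) + (q - w) * t" if "t \<le> d" for t
      proof -
        have "\<forall>e\<in>D. t \<le> e"
          using d(2) order_trans[OF that] by blast
        with aff[of t] that show ?thesis
          by (simp add: h'_def algebra_simps)
      qed
      have h'b: "h' b = f b"
        using d(3) by (simp add: h'_def w_def)
      have h'D: "h' e = f e" if "e \<in> D" for e
        using that eq d(2)[of e] by (simp add: h'_def max_def)
      have pd': "positive_definite_fun (\<lambda>t. h' \<bar>t\<bar>)"
        unfolding h'_def by (intro positive_definite_fun_add pd positive_definite_fun_tent w)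
      have le': "h' t \<le> f t" if t: "0 \<le> t" "t \<le> b" for t
      proof (cases "t = b")
        case False
        then have "t < b" using t by simp
        \<comment> \<open>Left of \<open>d\<close>, \<open>h'\<close> is the line through the graph
          points of \<open>f\<close> at \<open>b\<close> and \<open>d\<close>. Slopes of
          \<open>f\<close> increase, so beyond \<open>b\<close> on the left \<open>f\<close> stays
          above this extended chord.\<close>
        have "(f t - f b) / (t - b) \<le> (f t - f d) / (t - d)"
             "(f t - f d) / (t - d) \<le> (f b - f d) / (b - d)"
          using convex_on_slope_le[OF conv, of t d b] t d(3) \<open>t < b\<close> by auto
        then have *: "(f t - f b) / (t - b) \<le> (f b - f d) / (b - d)" by linarith
        define A B where "A = p + w * d" and "B = q - w"
        have "f b = A + B * b" "f d = A + B * d" "h' t = A + B * t"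
          using aff'[of b] aff'[of d] aff'[of t] h'b h'D[OF d(1)] d(3) t by (auto simp: A_def B_def)
        moreover from this d(3) have "(f b - f d) / (b - d) = B"
          by (simp add: field_simps)
        ultimately have "f t - (A + B * b) \<ge> B * (t - b)"
          using * \<open>t < b\<close> by (simp add: divide_le_eq)
        with \<open>h' t = A + B * t\<close> show ?thesis
          by (simp add: algebra_simps)
      qed (simp add: h'b)
      show ?thesis
        by (intro exI[of _ h'] exI[of _ "p + w * d"] exI[of _ "q - w"] conjI impI allI)
           (use pd' aff' le' h'b h'D d(3) in auto)
    qed
  qed
  then show ?thesis
    using that by blast
qed

theorem polya_criterion:
  fixes f :: "real \<Rightarrow> real"
  assumes "convex_on {0..} f" "antimono_on {0..} f" "\<And>t. 0 \<le> t \<Longrightarrow> 0 \<le> f t"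
  shows "positive_definite_fun (\<lambda>t. f \<bar>t\<bar>)"
  unfolding positive_definite_fun_def positive_definite_kernel_def
proof (intro conjI ballI allI impI)
  fix x y :: real
  show "complex_of_real (f \<bar>x - y\<bar>) = cnj (complex_of_real (f \<bar>y - x\<bar>))"
    by (simp add: abs_minus_commute)
next
  fix n :: nat and x :: "nat \<Rightarrow> real" and c :: "nat \<Rightarrow> complex"
  define D where "D = (\<lambda>(j, k). \<bar>x j - x k\<bar>) ` ({1..n} \<times> {1..n})"
  have "finite D" "D \<subseteq> {0..}"
    by (auto simp: D_def)
  then obtain h where h: "positive_definite_fun (\<lambda>t. h \<bar>t\<bar>)" and eq: "\<And>d. d \<in> D \<Longrightarrow> h d = f d"
    using polya_interpolation[OF assms] by metis
  have "(\<Sum>j=1..n. \<Sum>k=1..n. c j * cnj (c k) * complex_of_real (h \<bar>x j - x k\<bar>)) \<in> \<real>\<^sub>\<ge>\<^sub>0"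
    using h by (simp add: positive_definite_fun_def positive_definite_kernel_def)
  moreover have "h \<bar>x j - x k\<bar> = f \<bar>x j - x k\<bar>" if "j \<in> {1..n}" "k \<in> {1..n}" for j k
    using that by (intro eq) (auto simp: D_def)
  ultimately show "(\<Sum>j=1..n. \<Sum>k=1..n. c j * cnj (c k) * complex_of_real (f \<bar>x j - x k\<bar>)) \<in> \<real>\<^sub>\<ge>\<^sub>0"
    by simp
qed

section \<open>Left derivatives of convex functions\<close>

text \<open>Slopes into \<open>b\<close> increase as \<open>t\<close> approaches \<open>b\<close>,
  so their limit exists in the extended reals and is their supremum. In this form a bound on the
  derivative is a bound on every slope.\<close>

lemma left_deriv_convex_eq_SUP:
  fixes g :: "real \<Rightarrow> real"
  assumes conv: "convex_on {l..b} g" and "l < b"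
  shows "left_deriv g b = (SUP t\<in>{l..<b}. ereal ((g b - g t) / (b - t)))"
  unfolding left_deriv_def
proof (rule tendsto_Lim[OF trivial_limit_at_left_real], rule increasing_tendsto)
  let ?q = "\<lambda>t. ereal ((g b - g t) / (b - t))"
  have ev: "\<forall>\<^sub>F t in at_left b. t \<in> {s<..<b}" if "s < b" for s
    using that by (rule eventually_at_leftI[rotated]) auto
  show "\<forall>\<^sub>F t in at_left b. ?q t \<le> (SUP t\<in>{l..<b}. ?q t)"
    using ev[OF \<open>l < b\<close>] by eventually_elim (auto intro!: SUP_upper)
  fix y assume "y < (SUP t\<in>{l..<b}. ?q t)"
  then obtain s where s: "l \<le> s" "s < b" "y < ?q s"
    by (auto simp: less_SUP_iff)
  show "\<forall>\<^sub>F t in at_left b. y < ?q t"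
    using ev[OF \<open>s < b\<close>]
  proof eventually_elim
    case (elim t)
    have "(g s - g b) / (s - b) \<le> (g t - g b) / (t - b)"
      using convex_on_slope_le(2)[OF conv, of s b t] s elim by auto
    then have "?q s \<le> ?q t"
      by (metis ereal_less_eq(3) minus_diff_eq minus_divide_divide)
    with s(3) show ?case by (rule less_le_trans)
  qed
qed

text \<open>Every slope into \<open>b\<close> from the left is at most the slope from
  \<open>b\<close> to \<open>u\<close>, hence so is their supremum.\<close>

lemma left_deriv_convex_le_slope:
  fixes g :: "real \<Rightarrow> real"
  assumes conv: "convex_on {l..u} g" and "l < b" "b < u"
  shows "left_deriv g b \<le> ereal ((g u - g b) / (u - b))"
proof -
  have "convex_on {l..b} g"
    using conv by (rule convex_on_subset) (use assms in auto)
  then have "left_deriv g b = (SUP t\<in>{l..<b}. ereal ((g b - g t) / (b - t)))"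
    using \<open>l < b\<close> by (rule left_deriv_convex_eq_SUP)
  also have "\<dots> \<le> ereal ((g u - g b) / (u - b))"
  proof (intro SUP_least)
    fix t assume t: "t \<in> {l..<b}"
    have "(g t - g b) / (t - b) \<le> (g b - g u) / (b - u)"
      using convex_on_slope_le[OF conv, of t u b] t assms by auto
    then show "ereal ((g b - g t) / (b - t)) \<le> ereal ((g u - g b) / (u - b))"
      by (metis ereal_less_eq(3) minus_diff_eq minus_divide_divide)
  qed
  finally show ?thesis .
qed

text \<open>The supremum formula makes all slopes into \<open>b\<close> nonpositive; convexity
  bounds the slope from \<open>s\<close> to \<open>t\<close> by the one from \<open>s\<close> to
  \<open>b\<close>.\<close>

lemma antimono_on_convex_left_deriv_nonpos:
  fixes g :: "real \<Rightarrow> real"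
  assumes conv: "convex_on {l..b} g" and "l < b" and "left_deriv g b \<le> 0"
  shows "antimono_on {l..b} g"
proof (rule monotone_onI)
  fix s t assume st: "s \<in> {l..b}" "t \<in> {l..b}" "s \<le> t"
  have gb: "g b \<le> g r" if "r \<in> {l..<b}" for r
  proof -
    have "ereal ((g b - g r) / (b - r)) \<le> 0"
      using that assms(3) unfolding left_deriv_convex_eq_SUP[OF conv \<open>l < b\<close>]
      by (meson SUP_upper order_trans)
    with that show ?thesis by (simp add: divide_le_0_iff)
  qed
  consider "s = t" | "s < t" "t = b" | "s < t" "t < b" using st by fastforce
  then show "g t \<le> g s"
  proof cases
    case 3
    have "(g s - g t) / (s - t) \<le> (g s - g b) / (s - b)"
      using convex_on_slope_le(1)[OF conv, of s b t] st 3 by auto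
    moreover have "(g s - g b) / (s - b) \<le> 0"
      using gb[of s] st 3 by (auto simp: divide_le_0_iff)
    ultimately have "(g s - g t) / (s - t) \<le> 0" by linarith
    with 3 show ?thesis by (simp add: divide_le_0_iff)
  qed (use gb st in auto)
qed

text \<open>\<open>min t b\<close> is concave in \<open>t\<close>, and a nonincreasing convex
  function of a concave one is convex.\<close>

lemma convex_on_min:
  fixes g :: "real \<Rightarrow> real"
  assumes conv: "convex_on {0..b} g" and anti: "antimono_on {0..b} g" and "0 \<le> b"
  shows "convex_on {0..} (\<lambda>t. g (min t b))"
proof (rule convex_onI)
  fix v x y :: real
  assume v: "0 < v" "v < 1" and xy: "x \<in> {0..}" "y \<in> {0..}"
  have in_Icc: "min x b \<in> {0..b}" "min y b \<in> {0..b}"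
    using xy \<open>0 \<le> b\<close> by auto
  define z where "z = (1 - v) * min x b + v * min y b"
  have "z \<in> {0..b}"
    using convexD_alt[of "{0..b}" "min x b" "min y b" v] in_Icc v by (auto simp: z_def)
  moreover have "z \<le> (1 - v) * x + v * y"
    unfolding z_def using v by (intro add_mono mult_left_mono) auto
  ultimately have "g (min ((1 - v) * x + v * y) b) \<le> g z"
    using anti by (auto simp: monotone_on_def)
  also have "\<dots> \<le> (1 - v) * g (min x b) + v * g (min y b)"
    using convex_onD[OF conv, of v "min x b" "min y b"] in_Icc v by (simp add: z_def)
  finally show "g (min ((1 - v) *\<^sub>R x + v *\<^sub>R y) b) \<le> (1 - v) * g (min x b) + v * g (min y b)"
    by simp
qed simp

section \<open>The Laplace transform\<close>

context
  fixes \<mu> :: "real measure" and a :: real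
  assumes sets_mu: "sets \<mu> = sets borel"
    and a_nonneg: "0 \<le> a"
    and laplace_finite: "\<And>t. t \<in> {0..a} \<Longrightarrow> laplace \<mu> t < \<infinity>"
begin

lemma integrable_exp:
  assumes "t \<in> {0..a}"
  shows "integrable \<mu> (\<lambda>x. exp (- x * t))"
proof (rule integrableI_nonneg)
  show "(\<lambda>x. exp (- x * t)) \<in> borel_measurable \<mu>"
    unfolding measurable_cong_sets[OF sets_mu refl] by measurable
qed (use laplace_finite[OF assms] in \<open>auto simp: laplace_def\<close>)

lemma laplace_eq_integral:
  assumes "t \<in> {0..a}"
  shows "enn2real (laplace \<mu> t) = (\<integral>x. exp (- x * t) \<partial>\<mu>)"
  unfolding laplace_def
  using nn_integral_eq_integral[OF integrable_exp[OF assms]] by simp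

text \<open>For fixed x the map t -> exp(-x t) is convex, and integration preserves the
  inequality.\<close>

lemma convex_on_laplace: "convex_on {0..a} (\<lambda>t. enn2real (laplace \<mu> t))"
proof (rule convex_onI)
  fix v s t :: real
  assume v: "0 < v" "v < 1" and st: "s \<in> {0..a}" "t \<in> {0..a}"
  have mem: "(1 - v) * s + v * t \<in> {0..a}"
    using convexD_alt[of "{0..a}" s t v] st v by auto
  have "(\<integral>x. exp (- x * ((1 - v) * s + v * t)) \<partial>\<mu>)
      \<le> (\<integral>x. (1 - v) * exp (- x * s) + v * exp (- x * t) \<partial>\<mu>)"
  proof (rule integral_mono)
    show "exp (- x * ((1 - v) * s + v * t)) \<le> (1 - v) * exp (- x * s) + v * exp (- x * t)" for x
      using convex_onD[OF exp_convex, of v "- x * s" "- x * t"] v by (simp add: algebra_simps)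
  qed (use mem st integrable_exp in auto)
  also have "\<dots> = (1 - v) * (\<integral>x. exp (- x * s) \<partial>\<mu>) + v * (\<integral>x. exp (- x * t) \<partial>\<mu>)"
    using integrable_exp st by simp
  finally show "enn2real (laplace \<mu> ((1 - v) *\<^sub>R s + v *\<^sub>R t))
      \<le> (1 - v) * enn2real (laplace \<mu> s) + v * enn2real (laplace \<mu> t)"
    using mem st by (simp add: laplace_eq_integral)
qed simp

lemma continuous_on_laplace: "continuous_on {0..a} (\<lambda>t. enn2real (laplace \<mu> t))"
proof -
  \<comment> \<open>One integrable majorant for dominated convergence: the endpoint 0 controls
    \<open>x \<ge> 0\<close>, the endpoint \<open>a\<close> controls \<open>x < 0\<close>. The
    constant 1 is kept as \<open>exp (- x * 0)\<close> so that \<open>integrable_exp\<close> covers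
    both summands.\<close>
  have bound: "exp (- x * t) \<le> exp (- x * 0) + exp (- x * a)" if "t \<in> {0..a}" for x t
  proof (cases "0 \<le> x")
    case True
    with that have "exp (- x * t) \<le> 1" by simp
    also have "\<dots> \<le> exp (- x * 0) + exp (- x * a)" by simp
    finally show ?thesis .
  next
    case False
    with that have "exp (- x * t) \<le> exp (- x * a)" by (simp add: mult_left_mono_neg)
    also have "\<dots> \<le> exp (- x * 0) + exp (- x * a)" by simp
    finally show ?thesis .
  qed
  have "continuous_on {0..a} (\<lambda>t. \<integral>x. exp (- x * t) \<partial>\<mu>)"
    unfolding continuous_on_sequentially comp_def
  proof (intro allI ballI impI, elim conjE)
    fix u t assume t: "t \<in> {0..a}" and u: "\<forall>n. u n \<in> {0..a}" "u \<longlonglongrightarrow> t"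
    show "(\<lambda>n. \<integral>x. exp (- x * u n) \<partial>\<mu>) \<longlonglongrightarrow> (\<integral>x. exp (- x * t) \<partial>\<mu>)"
    proof (rule integral_dominated_convergence)
      show "integrable \<mu> (\<lambda>x. exp (- x * 0) + exp (- x * a))"
        using a_nonneg by (intro Bochner_Integration.integrable_add integrable_exp) auto
      show "AE x in \<mu>. (\<lambda>n. exp (- x * u n)) \<longlonglongrightarrow> exp (- x * t)"
        using u(2) by (intro AE_I2 tendsto_intros)
      show "AE x in \<mu>. norm (exp (- x * u n)) \<le> exp (- x * 0) + exp (- x * a)" for n
        using u(1) bound by (intro AE_I2) simp
    qed (use u(1) t integrable_exp in \<open>auto intro!: borel_measurable_integrable\<close>)
  qed
  then show ?thesis
    by (rule continuous_on_eq) (simp add: laplace_eq_integral)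
qed

lemma positive_definite_kernel_laplace_add:
  "positive_definite_kernel {0..a} (\<lambda>s t. complex_of_real (enn2real (laplace \<mu> ((t + s) / 2))))"
proof (rule positive_definite_kernel_Gram[where M = \<mu> and F = "\<lambda>s x. exp (- x * (s / 2))"])
  fix s t assume "s \<in> {0..a}" "t \<in> {0..a}"
  then have mem: "(t + s) / 2 \<in> {0..a}" by auto
  have prod: "exp (- x * (s / 2)) * exp (- x * (t / 2)) = exp (- x * ((t + s) / 2))" for x
    unfolding exp_add[symmetric] by (simp add: algebra_simps add_divide_distrib)
  show "integrable \<mu> (\<lambda>x. exp (- x * (s / 2)) * exp (- x * (t / 2)))"
    unfolding prod by (rule integrable_exp[OF mem])
  show "enn2real (laplace \<mu> ((t + s) / 2)) = (\<integral>x. exp (- x * (s / 2)) * exp (- x * (t / 2)) \<partial>\<mu>)"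
    unfolding prod by (rule laplace_eq_integral[OF mem])
qed

end

section \<open>Reflection positivity\<close>

text \<open>The first kernel, tested at the points -t and t with coefficients 1 and -1, gives 2
  phi(0) - phi(t) - phi(-t) >= 0. Hermitian symmetry of the real kernel gives phi(-t) =
  phi(t).\<close>

lemma reflection_positive_le_zero:
  assumes "reflection_positive a \<phi>" "\<bar>t\<bar> \<le> a"
  shows "\<phi> t \<le> \<phi> 0"
proof -
  let ?Q = "\<lambda>s t. complex_of_real (\<phi> ((t - s) / 2))"
  have pd: "positive_definite_kernel {-a..a} ?Q"
    using assms(1) by (simp add: reflection_positive_def)
  define x where "x = (\<lambda>j::nat. if j = 1 then - t else t)"
  define c where "c = (\<lambda>j::nat. if j = 1 then 1 else -1 :: complex)"
  have mem: "\<forall>j\<in>{1..2}. x j \<in> {-a..a}"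
    using assms(2) by (auto simp: x_def)
  have "(\<Sum>j=1..2. \<Sum>k=1..2. c j * cnj (c k) * ?Q (x j) (x k)) \<in> \<real>\<^sub>\<ge>\<^sub>0"
    using pd mem unfolding positive_definite_kernel_def by blast
  moreover have "{1..2} = {1, 2::nat}" by auto
  moreover have "?Q t (- t) = ?Q (- t) t"
  proof -
    have "t \<in> {-a..a}" "- t \<in> {-a..a}"
      using assms(2) by auto
    then have "?Q t (- t) = cnj (?Q (- t) t)"
      using pd unfolding positive_definite_kernel_def by blast
    then show ?thesis
      by (simp only: complex_cnj_complex_of_real)
  qed
  ultimately show ?thesis
    by (simp add: x_def c_def complex_nonneg_Reals_iff)
qed

theorem theorem5p8:
  fixes a :: real and \<mu> :: "real measure" and \<phi> :: "real \<Rightarrow> real"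
  assumes "a > 0"
    and "finite_measure \<mu>" and "sets \<mu> = sets borel"
    and "\<And>t. \<bar>t\<bar> \<le> a \<Longrightarrow> laplace \<mu> \<bar>t\<bar> < \<infinity>"
    and "\<And>t. \<bar>t\<bar> \<le> a \<Longrightarrow> \<phi> t = enn2real (laplace \<mu> \<bar>t\<bar>)"
  shows "(left_deriv (\<lambda>t. enn2real (laplace \<mu> t)) a \<le> 0 \<longrightarrow>
            reflection_positive a \<phi> \<and>
            (\<exists>\<Phi>. symmetric_fun \<Phi> \<and> positive_definite_fun \<Phi> \<and> (\<forall>t\<in>{-a..a}. \<Phi> t = \<phi> t))) \<and>
         (reflection_positive a \<phi> \<and> \<not> \<phi> constant_on {-a..a} \<longrightarrow>
            (\<exists>b\<in>{0<..a}. left_deriv (\<lambda>t. enn2real (laplace \<mu> t)) b < 0))"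
proof (intro conjI impI)
  have "0 \<le> a" using \<open>a > 0\<close> by simp
  have fin: "laplace \<mu> t < \<infinity>" if "t \<in> {0..a}" for t
    using assms(4)[of t] that by simp
  let ?g = "\<lambda>t. enn2real (laplace \<mu> t)"
  have conv: "convex_on {0..a} ?g"
    by (rule convex_on_laplace) (use assms(3) \<open>0 \<le> a\<close> fin in auto)
  have cont: "continuous_on {0..a} ?g"
    by (rule continuous_on_laplace) (use assms(3) \<open>0 \<le> a\<close> fin in auto)
  {
    assume "left_deriv ?g a \<le> 0"
    then have anti: "antimono_on {0..a} ?g"
      by (rule antimono_on_convex_left_deriv_nonpos[OF conv \<open>a > 0\<close>])
    \<comment> \<open>The extension is frozen at the value \<open>?g a\<close> beyond
      \<open>a\<close>; monotonicity of \<open>?g\<close> up to \<open>a\<close> keeps the corner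
      convex.\<close>
    let ?f = "\<lambda>t. ?g (min t a)"
    define \<Phi> where "\<Phi> = (\<lambda>t. ?f \<bar>t\<bar>)"
    have pd: "positive_definite_fun \<Phi>"
      unfolding \<Phi>_def
    proof (rule polya_criterion)
      show "convex_on {0..} ?f"
        by (rule convex_on_min[OF conv anti \<open>0 \<le> a\<close>])
      show "antimono_on {0..} ?f"
        using anti \<open>0 \<le> a\<close> by (auto simp: monotone_on_def)
    qed simp
    have eq: "\<Phi> t = \<phi> t" if "t \<in> {-a..a}" for t
      using that assms(5)[of t] by (auto simp: \<Phi>_def min_def)
    have sym: "\<Phi> (- t) = \<Phi> t" for t
      by (simp add: \<Phi>_def)
    then show "\<exists>\<Phi>. symmetric_fun \<Phi> \<and> positive_definite_fun \<Phi> \<and> (\<forall>t\<in>{-a..a}. \<Phi> t = \<phi> t)"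
      using pd eq by (intro exI[of _ \<Phi>]) (simp add: symmetric_fun_def)
    \<comment> \<open>Pulling back along s -> -s/2 produces both the factor 1/2 and the order
      \<open>t - s\<close> of the first kernel; half-differences of points of [-a,a] stay where
      \<open>\<Phi>\<close> equals \<open>\<phi>\<close>.\<close>
    have "positive_definite_kernel {-a..a} (\<lambda>s t. complex_of_real (\<Phi> ((- s) / 2 - (- t) / 2)))"
      by (rule positive_definite_kernel_compose[OF pd[unfolded positive_definite_fun_def]]) simp
    moreover have "(- s) / 2 - (- t) / 2 = (t - s) / 2" for s t :: real
      by (simp add: field_simps)
    moreover have "\<Phi> ((t - s) / 2) = \<phi> ((t - s) / 2)" if "s \<in> {-a..a}" "t \<in> {-a..a}" for s t
      using that by (intro eq) auto
    ultimately have *: "positive_definite_kernel {-a..a} (\<lambda>s t. complex_of_real (\<phi> ((t - s) / 2)))"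
      by (simp only: cong: positive_definite_kernel_cong)
    have "?g ((t + s) / 2) = \<phi> ((t + s) / 2)" if "s \<in> {0..a}" "t \<in> {0..a}" for s t
      using that assms(5)[of "(t + s) / 2"] by auto
    moreover have "positive_definite_kernel {0..a} (\<lambda>s t. complex_of_real (?g ((t + s) / 2)))"
      by (rule positive_definite_kernel_laplace_add) (use assms(3) \<open>0 \<le> a\<close> fin in auto)
    ultimately have "positive_definite_kernel {0..a} (\<lambda>s t. complex_of_real (\<phi> ((t + s) / 2)))"
      by (simp only: cong: positive_definite_kernel_cong)
    with * show "reflection_positive a \<phi>"
      by (simp add: reflection_positive_def)
  }
  assume "reflection_positive a \<phi> \<and> \<not> \<phi> constant_on {-a..a}"
  then have rp: "reflection_positive a \<phi>" and nc: "\<not> \<phi> constant_on {-a..a}" by auto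
  from nc obtain t0 where "t0 \<in> {-a..a}" "\<phi> t0 \<noteq> \<phi> 0"
    unfolding constant_on_def by blast
  then have t0: "\<bar>t0\<bar> \<le> a" "\<phi> t0 \<noteq> \<phi> 0"
    by auto
  define t where "t = \<bar>t0\<bar>"
  have t: "t \<in> {0<..a}" "?g t < ?g 0"
  proof -
    show "t \<in> {0<..a}"
      using t0 by (auto simp: t_def)
    show "?g t < ?g 0"
      using t0(2) reflection_positive_le_zero[OF rp t0(1)] assms(5)[OF t0(1)] assms(5)[of 0] \<open>0 \<le> a\<close>
      by (simp add: t_def)
  qed
  \<comment> \<open>The left derivative at \<open>t\<close> itself may be positive although
    \<open>?g t < ?g 0\<close>. Continuity at 0 supplies an earlier interior point \<open>b\<close>
    with \<open>?g b > ?g t\<close>, from which the chord to \<open>t\<close> still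
    descends.\<close>
  have "(?g \<longlongrightarrow> ?g 0) (at 0 within {0..a})"
    using cont \<open>0 \<le> a\<close> by (auto simp: continuous_on_def)
  then have "(?g \<longlongrightarrow> ?g 0) (at_right 0)"
    using \<open>a > 0\<close> by (simp add: at_within_Icc_at_right)
  then have "\<forall>\<^sub>F s in at_right 0. ?g t < ?g s"
    using t(2) by (rule order_tendstoD)
  moreover have "\<forall>\<^sub>F s in at_right 0. s \<in> {0<..<t}"
    using t by (intro eventually_at_right_real) simp
  ultimately have "\<forall>\<^sub>F s in at_right 0. ?g t < ?g s \<and> s \<in> {0<..<t}"
    by (rule eventually_conj)
  then obtain b where b: "?g t < ?g b" "0 < b" "b < t"
    using eventually_happens'[OF trivial_limit_at_right_real] by fastforce
  have "convex_on {0..t} ?g"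
    using conv by (rule convex_on_subset) (use t in auto)
  then have "left_deriv ?g b \<le> ereal ((?g t - ?g b) / (t - b))"
    using b by (intro left_deriv_convex_le_slope)
  also have "\<dots> < 0"
    using b by (simp add: divide_less_0_iff)
  finally show "\<exists>b\<in>{0<..a}. left_deriv ?g b < 0"
    using b t by (intro bexI[of _ b]) auto
qed

end
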